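(* Let $\mathcal M=(\{1,2\},S,A,P,R_2,\gamma,\sigma)$ be a finite two-agent MDP, $\pi_1^0\in\Pi^1$ a default policy, $\pi_2^\dagger\in\Pi^2_{\mathrm{det}}$ a target policy, $\epsilon\ge0$ and $p\ge1$. Assume that $P(s,a_1,a_2,s')=P(s,a_1',a_2,s')$ for all $s,s'\in S$, $a_1,a_1'\in A_1$, $a_2\in A_2$, and that $\mu^{\pi_1,\pi_2^\dagger}(s)>0$ for all $s\in S$ and all $\pi_1\in\Pi^1$. If $\alpha_2^*\ge\epsilon$, then the attack problem (P1) is feasible, and the cost of an optimal solution $\pi_1$ of (P1) satisfies $$\mathrm{Cost}(\pi_1,\pi_1^0)\ \le\ 2\cdot\left\|\frac{\overline\chi_\epsilon}{\chi_2^*+\overline\chi_\epsilon}\right\|_\infty\cdot|S|^{1/p},$$ where the division is element-wise over pairs $(s,a_2)$, with an entry equal to $0$ if $\overline\chi_\epsilon(s,a_2)=\chi_2^*(s,a_2)=0$, and $$\chi_2^*(s,a_2)=\frac{\alpha_2^*(s,a_2)-\epsilon}{\mu^{\pi_1^0,\pi_2^\dagger\{s,a_2\}}(s)}.$$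
   Context: A two-agent MDP $\mathcal M=(\{1,2\},S,A,P,R_2,\gamma,\sigma)$ has finite state space $S$, finite joint action space $A=A_1\times A_2$, transition model $P(s,a_1,a_2,s')$, reward function $R_2:S\times A_1\times A_2\to\mathbb R$ of agent 2, discount factor $\gamma$ ($0\le\gamma<1$), initial state distribution $\sigma$. $\Pi^i$ is the set of stochastic stationary policies $\pi_i:S\to\mathcal P(A_i)$, with $\pi_i(s,a_i)$ the probability of $a_i$ in $s$; $\Pi^2_{\mathrm{det}}\subseteq\Pi^2$ is the set of deterministic policies. $\rho_2^{\pi_1,\pi_2}=(1-\gamma)\,\mathbb E[\sum_{t\ge1}\gamma^{t-1}R_2(s_t,a_{1,t},a_{2,t})\mid\sigma,\pi_1,\pi_2]$; $\mu^{\pi_1,\pi_2}(s)=(1-\gamma)\,\mathbb E[\sum_{t\ge1}\gamma^{t-1}\mathbf 1[s_t=s]\mid\sigma,\pi_1,\pi_2]$. Neighbor policy: $\pi\{s,a\}$ equals $\pi$ in all states except $s$, where it takes $a$ with probability 1. $\Pi_2^\dagger(\pi_1)$ is the set of policies $\pi_2$ with $\pi_2(s,\cdot)=\pi_2^\dagger(s,\cdot)$ whenever $\mu^{\pi_1,\pi_2^\dagger}(s)>0$. The attack problem (P1): minimize $\mathrm{Cost}(\pi_1,\pi_1^0)$ over $\pi_1\in\Pi^1$ subject to $\rho_2^{\pi_1,\pi_2^\dagger}\ge\rho_2^{\pi_1,\pi_2}+\epsilon$ for all $\pi_2\in\Pi^2_{\mathrm{det}}\setminus\Pi_2^\dagger(\pi_1)$.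 Here $$\mathrm{Cost}(\pi_1,\pi_1^0)=\Big(\sum_{s}\Big(\sum_{a_1}|\pi_1(s,a_1)-\pi_1^0(s,a_1)|\Big)^{p}\Big)^{1/p}.$$ With $[x]^+=\max(0,x)$, $$\overline\chi_{\epsilon}(s,a_2)=\left[\frac{\rho_2^{\pi_1^0,\pi_2^\dagger\{s,a_2\}}-\rho_2^{\pi_1^0,\pi_2^\dagger}+\epsilon}{\mu^{\pi_1^0,\pi_2^\dagger\{s,a_2\}}(s)}\right]^+$$ if $\mu^{\pi_1,\pi_2^\dagger}(s)>0$ for all $\pi_1\in\Pi^1$ and $\pi_2^\dagger(s,a_2)=0$; otherwise $\overline\chi_\epsilon(s,a_2)=0$. Set $\alpha_2^{\pi_1}(s,a_2)=\rho_2^{\pi_1,\pi_2^\dagger}-\rho_2^{\pi_1,\pi_2^\dagger\{s,a_2\}}$ and $\alpha_2^*=\sup_{\pi_1\in\Pi^1}\min\{\alpha_2^{\pi_1}(s,a_2): s\in S,\ a_2\in A_2,\ \pi_2^\dagger(s,a_2)=0\}$. The supremum is attained; fix a policy $\pi_1^*$ attaining it and write $\alpha_2^*(s,a_2)=\alpha_2^{\pi_1^*}(s,a_2)$. $\|\cdot\|_\infty$ is the maximum absolute value over all entries $(s,a_2)$. *)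

theory Defs
  imports "HOL-Probability.Probability"
begin

text \<open>
  Finiteness of the state and action spaces is expressed by the type class \<open>finite\<close>; the joint action
  space is the product of the two action types. Only the reward of agent 2 is part of the model.
\<close>

record ('s, 'a1, 'a2) mdp =
  transition :: "'s \<Rightarrow> 'a1 \<Rightarrow> 'a2 \<Rightarrow> 's pmf"
  reward :: "'s \<Rightarrow> 'a1 \<Rightarrow> 'a2 \<Rightarrow> real"
  discount :: real
  initial :: "'s pmf"

text \<open>Stochastic stationary policies; the probability written \<open>\<pi>(s,a)\<close> is \<^term>\<open>pmf (\<pi> s) a\<close>.\<close>

type_synonym ('s, 'a) policy = "'s \<Rightarrow> 'a pmf"

definition deterministic :: "('s, 'a) policy \<Rightarrow> bool" where
  "deterministic \<pi> \<longleftrightarrow> (\<forall>s. \<exists>a. \<pi> s = return_pmf a)"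

definition neighbor :: "('s, 'a) policy \<Rightarrow> 's \<Rightarrow> 'a \<Rightarrow> ('s, 'a) policy" where
  "neighbor \<pi> s a = \<pi>(s := return_pmf a)"


section \<open>The process induced by a pair of policies\<close>

text \<open>In each state the two agents draw their actions independently.\<close>

definition act :: "('s, 'a1) policy \<Rightarrow> ('s, 'a2) policy \<Rightarrow> 's \<Rightarrow> ('s \<times> 'a1 \<times> 'a2) pmf" where
  "act \<pi>1 \<pi>2 s = map_pmf (Pair s) (pair_pmf (\<pi>1 s) (\<pi>2 s))"

text \<open>
  Conditional law of the \<open>n\<close>-th triple (state, action of agent 1, action of agent 2) given the
  triples \<open>\<omega> 0, \<dots>, \<omega> (n - 1)\<close>. Time starts at 0, so that index \<open>n\<close> is the time step \<open>t = n + 1\<close>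
  and carries the discount factor \<open>\<gamma> ^ n\<close>.
\<close>

definition kernel ::
  "('s, 'a1, 'a2) mdp \<Rightarrow> ('s, 'a1) policy \<Rightarrow> ('s, 'a2) policy
    \<Rightarrow> nat \<Rightarrow> (nat \<Rightarrow> 's \<times> 'a1 \<times> 'a2) \<Rightarrow> ('s \<times> 'a1 \<times> 'a2) measure" where
  "kernel M \<pi>1 \<pi>2 n \<omega> = measure_pmf
     (case n of
        0 \<Rightarrow> bind_pmf (initial M) (act \<pi>1 \<pi>2)
      | Suc m \<Rightarrow> (case \<omega> m of (s, a1, a2) \<Rightarrow> bind_pmf (transition M s a1 a2) (act \<pi>1 \<pi>2)))"

lemma Ionescu_Tulcea_kernel:
  fixes M :: "('s::finite, 'a1::finite, 'a2::finite) mdp"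
  shows "Ionescu_Tulcea (kernel M \<pi>1 \<pi>2) (\<lambda>_. count_space UNIV)"
proof (rule Ionescu_Tulcea.intro)
  fix n :: nat
  show "kernel M \<pi>1 \<pi>2 n
      \<in> measurable (PiM {0..<n} (\<lambda>_. count_space UNIV)) (subprob_algebra (count_space UNIV))"
  proof (cases n)
    case 0
    then show ?thesis
      by (simp add: kernel_def[abs_def] measure_pmf_in_subprob_algebra)
  next
    case (Suc m)
    define F where "F = (\<lambda>x. case x of (s, a1, a2) \<Rightarrow>
      measure_pmf (bind_pmf (transition M s a1 a2) (act \<pi>1 \<pi>2)))"
    have "(\<lambda>\<omega>. \<omega> m) \<in> measurable (PiM {0..<n} (\<lambda>_. count_space UNIV))
        (count_space (UNIV :: ('s \<times> 'a1 \<times> 'a2) set))"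
      using Suc by (intro measurable_component_singleton) simp
    moreover have "F \<in> measurable (count_space UNIV) (subprob_algebra (count_space UNIV))"
      by (auto simp: F_def space_subprob_algebra split: prod.split
               intro!: measure_pmf.subprob_space_axioms)
    ultimately have "(\<lambda>\<omega>. F (\<omega> m))
        \<in> measurable (PiM {0..<n} (\<lambda>_. count_space UNIV)) (subprob_algebra (count_space UNIV))"
      by (rule measurable_compose)
    moreover have "kernel M \<pi>1 \<pi>2 n = (\<lambda>\<omega>. F (\<omega> m))"
      using Suc by (auto simp: kernel_def F_def fun_eq_iff split: prod.split)
    ultimately show ?thesis by simp
  qed
next
  fix n :: nat and \<omega> :: "nat \<Rightarrow> 's \<times> 'a1 \<times> 'a2"
  show "prob_space (kernel M \<pi>1 \<pi>2 n \<omega>)"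
    unfolding kernel_def by (rule measure_pmf.prob_space_axioms)
qed

text \<open>The law of the whole trajectory, obtained from the Ionescu-Tulcea extension theorem.\<close>

definition trajectory ::
  "('s::finite, 'a1::finite, 'a2::finite) mdp \<Rightarrow> ('s, 'a1) policy \<Rightarrow> ('s, 'a2) policy
    \<Rightarrow> (nat \<Rightarrow> 's \<times> 'a1 \<times> 'a2) measure" where
  "trajectory M \<pi>1 \<pi>2 =
     projective_family.lim UNIV
       (Ionescu_Tulcea.CI (kernel M \<pi>1 \<pi>2) (\<lambda>_. count_space UNIV)) (\<lambda>_. count_space UNIV)"

lemma prob_space_trajectory: "prob_space (trajectory M \<pi>1 \<pi>2)"
proof -
  interpret Ionescu_Tulcea "kernel M \<pi>1 \<pi>2" "\<lambda>_. count_space UNIV"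
    by (rule Ionescu_Tulcea_kernel)
  interpret C: prob_space "CI {}"
    by (rule PF.prob_space_P) simp_all
  have sp: "space (CI {}) = {\<lambda>_. undefined}"
    by (simp add: PF.space_P space_PiM)
  have "emeasure PF.lim (PF.emb UNIV {} {\<lambda>_. undefined}) = emeasure (CI {}) {\<lambda>_. undefined}"
    by (rule lim) (simp_all add: sets_PiM_empty)
  also have "\<dots> = 1"
    using C.emeasure_space_1 by (simp add: sp)
  also have "PF.emb UNIV {} {\<lambda>_. undefined} = space PF.lim"
    by (auto simp: prod_emb_def space_PiM PF.space_lim)
  finally show ?thesis
    unfolding trajectory_def by (rule prob_spaceI)
qed

definition rho ::
  "('s::finite, 'a1::finite, 'a2::finite) mdp \<Rightarrow> ('s, 'a1) policy \<Rightarrow> ('s, 'a2) policy \<Rightarrow> real" where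
  "rho M \<pi>1 \<pi>2 = (1 - discount M) *
     (\<integral>\<omega>. (\<Sum>n. discount M ^ n * (case \<omega> n of (s, a1, a2) \<Rightarrow> reward M s a1 a2)) \<partial>trajectory M \<pi>1 \<pi>2)"

definition occ ::
  "('s::finite, 'a1::finite, 'a2::finite) mdp \<Rightarrow> ('s, 'a1) policy \<Rightarrow> ('s, 'a2) policy \<Rightarrow> 's \<Rightarrow> real"
  where
  "occ M \<pi>1 \<pi>2 s = (1 - discount M) *
     (\<integral>\<omega>. (\<Sum>n. discount M ^ n * indicator {s} (fst (\<omega> n))) \<partial>trajectory M \<pi>1 \<pi>2)"


section \<open>The attack problem\<close>

definition cost :: "real \<Rightarrow> ('s::finite, 'a1::finite) policy \<Rightarrow> ('s, 'a1) policy \<Rightarrow> real" where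
  "cost p \<pi>1 \<pi>0 = (\<Sum>s\<in>UNIV. (\<Sum>a\<in>UNIV. \<bar>pmf (\<pi>1 s) a - pmf (\<pi>0 s) a\<bar>) powr p) powr (1 / p)"

text \<open>Below, \<open>d\<close> is the target policy of agent 2 and \<open>\<pi>0\<close> the default policy of agent 1.\<close>

definition target_class ::
  "('s::finite, 'a1::finite, 'a2::finite) mdp \<Rightarrow> ('s, 'a2) policy \<Rightarrow> ('s, 'a1) policy
    \<Rightarrow> ('s, 'a2) policy set" where
  "target_class M d \<pi>1 = {\<pi>2. \<forall>s. occ M \<pi>1 d s > 0 \<longrightarrow> \<pi>2 s = d s}"

definition attack_feasible ::
  "('s::finite, 'a1::finite, 'a2::finite) mdp \<Rightarrow> ('s, 'a2) policy \<Rightarrow> real \<Rightarrow> ('s, 'a1) policy \<Rightarrow> bool"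
  where
  "attack_feasible M d \<epsilon> \<pi>1 \<longleftrightarrow>
     (\<forall>\<pi>2 \<in> Collect deterministic - target_class M d \<pi>1. rho M \<pi>1 d \<ge> rho M \<pi>1 \<pi>2 + \<epsilon>)"

definition attack_optimal ::
  "('s::finite, 'a1::finite, 'a2::finite) mdp \<Rightarrow> ('s, 'a2) policy \<Rightarrow> real \<Rightarrow> real
    \<Rightarrow> ('s, 'a1) policy \<Rightarrow> ('s, 'a1) policy \<Rightarrow> bool" where
  "attack_optimal M d \<epsilon> p \<pi>0 \<pi>1 \<longleftrightarrow>
     is_arg_min (\<lambda>\<pi>. cost p \<pi> \<pi>0) (attack_feasible M d \<epsilon>) \<pi>1"


section \<open>Quantities in the cost bound\<close>

definition chi_bar ::
  "('s::finite, 'a1::finite, 'a2::finite) mdp \<Rightarrow> ('s, 'a2) policy \<Rightarrow> real \<Rightarrow> ('s, 'a1) policy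
    \<Rightarrow> 's \<Rightarrow> 'a2 \<Rightarrow> real" where
  "chi_bar M d \<epsilon> \<pi>0 s a =
     (if (\<forall>\<pi>1. occ M \<pi>1 d s > 0) \<and> pmf (d s) a = 0
      then max 0 ((rho M \<pi>0 (neighbor d s a) - rho M \<pi>0 d + \<epsilon>) / occ M \<pi>0 (neighbor d s a) s)
      else 0)"

definition alpha ::
  "('s::finite, 'a1::finite, 'a2::finite) mdp \<Rightarrow> ('s, 'a2) policy \<Rightarrow> ('s, 'a1) policy
    \<Rightarrow> 's \<Rightarrow> 'a2 \<Rightarrow> real" where
  "alpha M d \<pi>1 s a = rho M \<pi>1 d - rho M \<pi>1 (neighbor d s a)"

text \<open>
  The minimum over the finitely many off-target pairs is an infimum in the extended reals. It only
  differs from a real minimum if there are no such pairs, i.e. if agent 2 has a single action, in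
  which case it is \<open>\<infinity>\<close>.
\<close>

definition alpha_min ::
  "('s::finite, 'a1::finite, 'a2::finite) mdp \<Rightarrow> ('s, 'a2) policy \<Rightarrow> ('s, 'a1) policy \<Rightarrow> ereal" where
  "alpha_min M d \<pi>1 = (INF (s, a) \<in> {(s, a). pmf (d s) a = 0}. ereal (alpha M d \<pi>1 s a))"

definition alpha_star ::
  "('s::finite, 'a1::finite, 'a2::finite) mdp \<Rightarrow> ('s, 'a2) policy \<Rightarrow> ereal" where
  "alpha_star M d = (SUP \<pi>1. alpha_min M d \<pi>1)"

definition attains_alpha_star ::
  "('s::finite, 'a1::finite, 'a2::finite) mdp \<Rightarrow> ('s, 'a2) policy \<Rightarrow> ('s, 'a1) policy \<Rightarrow> bool" where
  "attains_alpha_star M d \<pi>1 \<longleftrightarrow> alpha_min M d \<pi>1 = alpha_star M d"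

definition chi_star ::
  "('s::finite, 'a1::finite, 'a2::finite) mdp \<Rightarrow> ('s, 'a2) policy \<Rightarrow> real \<Rightarrow> ('s, 'a1) policy
    \<Rightarrow> ('s, 'a1) policy \<Rightarrow> 's \<Rightarrow> 'a2 \<Rightarrow> real" where
  "chi_star M d \<epsilon> \<pi>0 \<pi>star s a =
     (alpha M d \<pi>star s a - \<epsilon>) / occ M \<pi>0 (neighbor d s a) s"

definition chi_ratio ::
  "('s::finite, 'a1::finite, 'a2::finite) mdp \<Rightarrow> ('s, 'a2) policy \<Rightarrow> real \<Rightarrow> ('s, 'a1) policy
    \<Rightarrow> ('s, 'a1) policy \<Rightarrow> 's \<Rightarrow> 'a2 \<Rightarrow> real" where
  "chi_ratio M d \<epsilon> \<pi>0 \<pi>star s a =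
     (if chi_bar M d \<epsilon> \<pi>0 s a = 0 \<and> chi_star M d \<epsilon> \<pi>0 \<pi>star s a = 0 then 0
      else chi_bar M d \<epsilon> \<pi>0 s a / (chi_star M d \<epsilon> \<pi>0 \<pi>star s a + chi_bar M d \<epsilon> \<pi>0 s a))"

definition sup_norm :: "('s::finite \<Rightarrow> 'a::finite \<Rightarrow> real) \<Rightarrow> real" where
  "sup_norm f = Max (range (\<lambda>(s, a). \<bar>f s a\<bar>))"

end

theory Submission
  imports Defs
begin

text \<open>
  Since transitions ignore agent 1, the occupancy measure depends on agent 2's policy only, so \<open>rho\<close> is
  affine in the policy of agent 1. By the performance difference identity it suffices to enforce the
  attack constraints for one-state deviations from the target. Mixing \<open>\<pi>0\<close> with weight \<open>1 - l\<close> and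
  \<open>\<pi>star\<close> with weight \<open>l\<close> satisfies these constraints for \<open>l = sup_norm (chi_ratio \<dots>)\<close>, and changes each
  state by at most \<open>2 l\<close> in the \<open>l\<^sup>1\<close>-norm. Optimal policies exist because the feasible policies form a
  compact set.
\<close>

section \<open>Marginals of the trajectory law\<close>

definition state_step ::
  "('s, 'a1, 'a2) mdp \<Rightarrow> ('s, 'a1) policy \<Rightarrow> ('s, 'a2) policy \<Rightarrow> 's \<Rightarrow> 's pmf" where
  "state_step M \<pi>1 \<pi>2 s = bind_pmf (act \<pi>1 \<pi>2 s) (\<lambda>(s, a1, a2). transition M s a1 a2)"

definition chain_law :: "'s pmf \<Rightarrow> ('s \<Rightarrow> 's pmf) \<Rightarrow> nat \<Rightarrow> 's pmf" where
  "chain_law \<sigma> K n = ((\<lambda>p. bind_pmf p K) ^^ n) \<sigma>"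

lemma chain_law_0 [simp]: "chain_law \<sigma> K 0 = \<sigma>"
  and chain_law_Suc [simp]: "chain_law \<sigma> K (Suc n) = bind_pmf (chain_law \<sigma> K n) K"
  by (simp_all add: chain_law_def)

definition joint_law ::
  "('s, 'a1, 'a2) mdp \<Rightarrow> ('s, 'a1) policy \<Rightarrow> ('s, 'a2) policy \<Rightarrow> nat \<Rightarrow> ('s \<times> 'a1 \<times> 'a2) pmf" where
  "joint_law M \<pi>1 \<pi>2 n =
     bind_pmf (chain_law (initial M) (state_step M \<pi>1 \<pi>2) n) (act \<pi>1 \<pi>2)"

text \<open>Brings the law into the recursive form of \<open>kernel\<close>, where the next triple
  is drawn from the current triple and not from the state alone.\<close>

lemma joint_law_Suc:
  "joint_law M \<pi>1 \<pi>2 (Suc n) =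
     bind_pmf (joint_law M \<pi>1 \<pi>2 n) (\<lambda>(s, a1, a2). bind_pmf (transition M s a1 a2) (act \<pi>1 \<pi>2))"
  by (simp add: joint_law_def state_step_def bind_assoc_pmf case_prod_unfold)

text \<open>Returns and occupancies are series of functions of single coordinates, so
  one-dimensional marginals suffice. They are computed for the finite-horizon measures
  \<open>C 0 n\<close> by induction and carried to the projective limit by restriction to
  \<open>{n}\<close>.\<close>

lemma nn_integral_trajectory:
  fixes M :: "('s::finite, 'a1::finite, 'a2::finite) mdp" and f :: "'s \<times> 'a1 \<times> 'a2 \<Rightarrow> ennreal"
  shows "(\<integral>\<^sup>+\<omega>. f (\<omega> n) \<partial>trajectory M \<pi>1 \<pi>2) = (\<integral>\<^sup>+x. f x \<partial>joint_law M \<pi>1 \<pi>2 n)"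
proof -
  interpret Ionescu_Tulcea "kernel M \<pi>1 \<pi>2" "\<lambda>_. count_space UNIV"
    by (rule Ionescu_Tulcea_kernel)
  \<comment> \<open>The empty history: the only point of the product over an empty index
    set.\<close>
  let ?u = "\<lambda>_. undefined"
  have u: "?u \<in> space (PiM {0..<0} (\<lambda>_. count_space (UNIV :: ('s \<times> 'a1 \<times> 'a2) set)))"
    by (simp add: space_PiM PiE_iff extensional_def)
  have meas: "(\<lambda>\<omega>. g (\<omega> n)) \<in> borel_measurable (PiM I (\<lambda>_. count_space UNIV))"
    if "n \<in> I" for g :: "'s \<times> 'a1 \<times> 'a2 \<Rightarrow> ennreal" and n :: nat and I
    using that by (intro measurable_compose[OF measurable_component_singleton]) simp_all
  have step: "(\<integral>\<^sup>+\<omega>. g (\<omega> n) \<partial>C 0 (Suc n) ?u) = (\<integral>\<^sup>+\<omega>. (\<integral>\<^sup>+x. g x \<partial>kernel M \<pi>1 \<pi>2 n \<omega>) \<partial>C 0 n ?u)"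
    for g :: "'s \<times> 'a1 \<times> 'a2 \<Rightarrow> ennreal" and n
  proof -
    have sp: "space (C 0 n ?u) = space (PiM {0..<n} (\<lambda>_. count_space UNIV))"
      using space_C[OF u, of n] by simp
    have "(\<integral>\<^sup>+\<omega>. g (\<omega> n) \<partial>C 0 (Suc n) ?u) = (\<integral>\<^sup>+\<omega>. (\<integral>\<^sup>+x. g (x n) \<partial>eP n \<omega>) \<partial>C 0 n ?u)"
      unfolding C.simps add_0
    proof (rule nn_integral_bind[where B = "PiM {0..<Suc n} (\<lambda>_. count_space UNIV)"])
      show "eP n \<in> C 0 n ?u \<rightarrow>\<^sub>M subprob_algebra (PiM {0..<Suc n} (\<lambda>_. count_space UNIV))"
        using measurable_eP sets_C[OF u, of n]
        by (subst measurable_cong_sets) auto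
    qed (rule meas, simp)
    also have "\<dots> = (\<integral>\<^sup>+\<omega>. (\<integral>\<^sup>+x. g x \<partial>kernel M \<pi>1 \<pi>2 n \<omega>) \<partial>C 0 n ?u)"
      by (intro nn_integral_cong, subst nn_integral_eP) (auto simp: sp intro!: meas)
    finally show ?thesis .
  qed
  have C_law: "(\<integral>\<^sup>+\<omega>. g (\<omega> n) \<partial>C 0 (Suc n) ?u) = (\<integral>\<^sup>+x. g x \<partial>joint_law M \<pi>1 \<pi>2 n)"
    for g :: "'s \<times> 'a1 \<times> 'a2 \<Rightarrow> ennreal" and n
  proof (induction n arbitrary: g)
    case 0
    interpret C: prob_space "C 0 0 ?u" by (rule prob_space_C[OF u])
    show ?case
      unfolding step by (simp add: kernel_def joint_law_def C.emeasure_space_1 del: C.simps)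
  next
    case (Suc n)
    have "(\<integral>\<^sup>+\<omega>. g (\<omega> (Suc n)) \<partial>C 0 (Suc (Suc n)) ?u) =
      (\<integral>\<^sup>+\<omega>. (\<lambda>(s, a1, a2). \<integral>\<^sup>+x. g x \<partial>bind_pmf (transition M s a1 a2) (act \<pi>1 \<pi>2)) (\<omega> n) \<partial>C 0 (Suc n) ?u)"
      unfolding step[of "Suc n" g] by (simp add: kernel_def case_prod_unfold del: C.simps)
    then show ?case
      unfolding Suc.IH joint_law_Suc by (simp add: case_prod_unfold)
  qed
  \<comment> \<open>\<open>CI {n}\<close> is a projection of \<open>C 0 (up_to {n})\<close>, and the
    shortest horizon containing coordinate \<open>n\<close> has length \<open>Suc n\<close>.\<close>
  have up_to: "up_to {n} = Suc n"
    unfolding up_to_def by (rule Least_equality) (auto simp: not_less_eq_eq[symmetric])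
  have "(\<integral>\<^sup>+\<omega>. f (\<omega> n) \<partial>PF.lim) = (\<integral>\<^sup>+\<omega>. f (restrict \<omega> {n} n) \<partial>PF.lim)"
    by simp
  also have "\<dots> = (\<integral>\<^sup>+\<omega>. f (\<omega> n) \<partial>distr PF.lim (PiM {n} (\<lambda>_. count_space UNIV)) (\<lambda>x. restrict x {n}))"
  proof (rule nn_integral_distr[symmetric])
    show "(\<lambda>x. restrict x {n}) \<in> PF.lim \<rightarrow>\<^sub>M PiM {n} (\<lambda>_. count_space UNIV)"
      by (subst measurable_cong_sets[OF PF.sets_lim refl]) (rule measurable_restrict_subset, simp)
  qed (simp add: meas)
  also have "\<dots> = (\<integral>\<^sup>+\<omega>. f (\<omega> n) \<partial>CI {n})"
    by (subst distr_lim) simp_all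
  also have "\<dots> = (\<integral>\<^sup>+\<omega>. f (restrict \<omega> {n} n) \<partial>C 0 (Suc n) ?u)"
    unfolding CI_def up_to
  proof (rule nn_integral_distr)
    show "(\<lambda>x. restrict x {n}) \<in> C 0 (Suc n) ?u \<rightarrow>\<^sub>M PiM {n} (\<lambda>_. count_space UNIV)"
      by (subst measurable_cong_sets[OF sets_C[OF u] refl]) (rule measurable_restrict_subset, simp)
  qed (simp add: meas)
  also have "\<dots> = (\<integral>\<^sup>+x. f x \<partial>joint_law M \<pi>1 \<pi>2 n)"
    using C_law by simp
  finally show ?thesis
    unfolding trajectory_def .
qed

section \<open>Discounted sums along trajectories\<close>

lemma sets_trajectory:
  fixes M :: "('s::finite, 'a1::finite, 'a2::finite) mdp"
  shows "sets (trajectory M \<pi>1 \<pi>2) = sets (PiM UNIV (\<lambda>_. count_space UNIV))"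
proof -
  interpret Ionescu_Tulcea "kernel M \<pi>1 \<pi>2" "\<lambda>_. count_space UNIV"
    by (rule Ionescu_Tulcea_kernel)
  show ?thesis unfolding trajectory_def by simp
qed

lemma measurable_trajectory:
  fixes M :: "('s::finite, 'a1::finite, 'a2::finite) mdp"
  shows "(\<lambda>\<omega>. \<omega> n) \<in> trajectory M \<pi>1 \<pi>2 \<rightarrow>\<^sub>M count_space UNIV"
  by (subst measurable_cong_sets[OF sets_trajectory refl]) (rule measurable_component_singleton, simp)

lemma distr_trajectory:
  fixes M :: "('s::finite, 'a1::finite, 'a2::finite) mdp"
  shows "distr (trajectory M \<pi>1 \<pi>2) (count_space UNIV) (\<lambda>\<omega>. \<omega> n) = joint_law M \<pi>1 \<pi>2 n"
proof (rule measure_eqI)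
  fix A
  have "emeasure (distr (trajectory M \<pi>1 \<pi>2) (count_space UNIV) (\<lambda>\<omega>. \<omega> n)) A =
      (\<integral>\<^sup>+x. indicator A x \<partial>distr (trajectory M \<pi>1 \<pi>2) (count_space UNIV) (\<lambda>\<omega>. \<omega> n))"
    by simp
  also have "\<dots> = (\<integral>\<^sup>+\<omega>. indicator A (\<omega> n) \<partial>trajectory M \<pi>1 \<pi>2)"
    by (rule nn_integral_distr[OF measurable_trajectory]) simp
  also have "\<dots> = (\<integral>\<^sup>+x. indicator A x \<partial>joint_law M \<pi>1 \<pi>2 n)"
    by (rule nn_integral_trajectory)
  also have "\<dots> = emeasure (joint_law M \<pi>1 \<pi>2 n) A"
    by simp
  finally show "emeasure (distr (trajectory M \<pi>1 \<pi>2) (count_space UNIV) (\<lambda>\<omega>. \<omega> n)) A =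
    emeasure (joint_law M \<pi>1 \<pi>2 n) A" .
qed simp

lemma bounded_finite_type:
  fixes f :: "'a::finite \<Rightarrow> real"
  obtains B where "\<And>x. \<bar>f x\<bar> \<le> B"
  using that[of "Max (range (\<lambda>x. \<bar>f x\<bar>))"] by simp

text \<open>A function on a finite type is bounded by some \<open>B\<close>, so the geometric series
  \<open>\<gamma> ^ n * B\<close> dominates and permits exchanging series and integral.\<close>

lemma integral_discounted_trajectory:
  fixes M :: "('s::finite, 'a1::finite, 'a2::finite) mdp" and f :: "'s \<times> 'a1 \<times> 'a2 \<Rightarrow> real"
  assumes "0 \<le> \<gamma>" "\<gamma> < 1"
  shows "(\<integral>\<omega>. (\<Sum>n. \<gamma> ^ n * f (\<omega> n)) \<partial>trajectory M \<pi>1 \<pi>2) =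
    (\<Sum>n. \<gamma> ^ n * measure_pmf.expectation (joint_law M \<pi>1 \<pi>2 n) f)"
proof -
  interpret prob_space "trajectory M \<pi>1 \<pi>2" by (rule prob_space_trajectory)
  obtain B where B: "\<And>x. \<bar>f x\<bar> \<le> B" using bounded_finite_type by blast
  have meas: "(\<lambda>\<omega>. f (\<omega> n)) \<in> borel_measurable (trajectory M \<pi>1 \<pi>2)" for n
    by (rule measurable_compose[OF measurable_trajectory]) simp
  have int: "integrable (trajectory M \<pi>1 \<pi>2) (\<lambda>\<omega>. f (\<omega> n))" for n
    by (rule integrable_const_bound[of _ B]) (auto intro!: meas B)
  have geo: "summable (\<lambda>n. \<gamma> ^ n * B)"
    using assms by (intro summable_mult2 summable_geometric) simp
  have le: "norm (\<gamma> ^ n * f x) \<le> \<gamma> ^ n * B" for n x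
    using assms B[of x] by (simp add: abs_mult mult_left_mono)
  have "(\<integral>\<omega>. (\<Sum>n. \<gamma> ^ n * f (\<omega> n)) \<partial>trajectory M \<pi>1 \<pi>2) =
      (\<Sum>n. \<integral>\<omega>. \<gamma> ^ n * f (\<omega> n) \<partial>trajectory M \<pi>1 \<pi>2)"
  proof (rule integral_suminf)
    show "AE \<omega> in trajectory M \<pi>1 \<pi>2. summable (\<lambda>n. norm (\<gamma> ^ n * f (\<omega> n)))"
      by (intro AE_I2 summable_comparison_test'[OF geo, of 0]) (simp add: le[simplified])
    show "summable (\<lambda>n. \<integral>\<omega>. norm (\<gamma> ^ n * f (\<omega> n)) \<partial>trajectory M \<pi>1 \<pi>2)"
    proof (rule summable_comparison_test'[OF geo, of 0])
      fix n
      have "(\<integral>\<omega>. norm (\<gamma> ^ n * f (\<omega> n)) \<partial>trajectory M \<pi>1 \<pi>2) \<le> \<gamma> ^ n * B"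
        using int[of n] by (intro integral_le_const AE_I2 le) (auto intro!: integrable_norm)
      then show "norm (\<integral>\<omega>. norm (\<gamma> ^ n * f (\<omega> n)) \<partial>trajectory M \<pi>1 \<pi>2) \<le> \<gamma> ^ n * B"
        by simp
    qed
  qed (use int in auto)
  also have "\<dots> = (\<Sum>n. \<gamma> ^ n * measure_pmf.expectation (joint_law M \<pi>1 \<pi>2 n) f)"
    by (simp add: distr_trajectory[symmetric] integral_distr[OF measurable_trajectory])
  finally show ?thesis .
qed

section \<open>Discounted occupancy of a finite Markov chain\<close>

lemma expectation_finite:
  fixes p :: "'a::finite pmf" and f :: "'a \<Rightarrow> real"
  shows "measure_pmf.expectation p f = (\<Sum>x\<in>UNIV. pmf p x * f x)"
  by (subst integral_measure_pmf[of UNIV]) simp_all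

lemma expectation_bind_finite:
  fixes p :: "'a::finite pmf" and q :: "'a \<Rightarrow> 'b::finite pmf" and f :: "'b \<Rightarrow> real"
  shows "measure_pmf.expectation (bind_pmf p q) f =
    (\<Sum>x\<in>UNIV. pmf p x * measure_pmf.expectation (q x) f)"
  by (subst pmf_expectation_bind[of UNIV]) simp_all

text \<open>Stated for an arbitrary chain, so that policy pairs can be compared through their state
  kernels alone.\<close>

definition discounted_occ :: "real \<Rightarrow> 's pmf \<Rightarrow> ('s \<Rightarrow> 's pmf) \<Rightarrow> 's \<Rightarrow> real" where
  "discounted_occ \<gamma> \<sigma> K s = (1 - \<gamma>) * (\<Sum>n. \<gamma> ^ n * pmf (chain_law \<sigma> K n) s)"

lemma summable_discounted_pmf:
  assumes "0 \<le> \<gamma>" "\<gamma> < (1::real)"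
  shows "summable (\<lambda>n. \<gamma> ^ n * pmf (p n) s)"
proof (rule summable_comparison_test'[OF summable_geometric[of \<gamma>], of 0])
  show "norm \<gamma> < 1" using assms by simp
  show "norm (\<gamma> ^ n * pmf (p n) s) \<le> \<gamma> ^ n" for n
    using assms by (simp add: abs_mult mult_left_le pmf_le_1)
qed

lemma discounted_occ_nonneg:
  assumes "0 \<le> \<gamma>" "\<gamma> < (1::real)"
  shows "discounted_occ \<gamma> \<sigma> K s \<ge> 0"
  unfolding discounted_occ_def
  using assms by (intro mult_nonneg_nonneg suminf_nonneg summable_discounted_pmf) auto

lemma discounted_expectation:
  fixes f :: "'s::finite \<Rightarrow> real"
  assumes "0 \<le> \<gamma>" "\<gamma> < 1"
  shows "(1 - \<gamma>) * (\<Sum>n. \<gamma> ^ n * measure_pmf.expectation (chain_law \<sigma> K n) f) =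
    (\<Sum>s\<in>UNIV. discounted_occ \<gamma> \<sigma> K s * f s)"
proof -
  have "(\<Sum>n. \<gamma> ^ n * measure_pmf.expectation (chain_law \<sigma> K n) f) =
      (\<Sum>n. \<Sum>s\<in>UNIV. \<gamma> ^ n * pmf (chain_law \<sigma> K n) s * f s)"
    by (simp add: expectation_finite sum_distrib_left mult.assoc)
  also have "\<dots> = (\<Sum>s\<in>UNIV. \<Sum>n. \<gamma> ^ n * pmf (chain_law \<sigma> K n) s * f s)"
    using assms by (intro suminf_sum summable_mult2 summable_discounted_pmf)
  also have "\<dots> = (\<Sum>s\<in>UNIV. (\<Sum>n. \<gamma> ^ n * pmf (chain_law \<sigma> K n) s) * f s)"
    using assms by (intro sum.cong refl suminf_mult2[symmetric] summable_discounted_pmf)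
  finally show ?thesis
    by (simp add: discounted_occ_def sum_distrib_left mult.assoc)
qed

text \<open>Split off the term \<open>n = 0\<close> of the series; in the remaining tail one factor
  \<gamma> comes out and the last transition is an expectation over the previous state.\<close>

lemma discounted_occ_flow:
  fixes K :: "'s::finite \<Rightarrow> 's pmf"
  assumes "0 \<le> \<gamma>" "\<gamma> < 1"
  shows "discounted_occ \<gamma> \<sigma> K t =
    (1 - \<gamma>) * pmf \<sigma> t + \<gamma> * (\<Sum>s\<in>UNIV. discounted_occ \<gamma> \<sigma> K s * pmf (K s) t)"
proof -
  have "(\<Sum>n. \<gamma> ^ n * pmf (chain_law \<sigma> K n) t) =
      pmf \<sigma> t + (\<Sum>n. \<gamma> ^ Suc n * pmf (chain_law \<sigma> K (Suc n)) t)"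
    using suminf_split_head[OF summable_discounted_pmf[OF assms, of "chain_law \<sigma> K" t]] by simp
  also have "(\<Sum>n. \<gamma> ^ Suc n * pmf (chain_law \<sigma> K (Suc n)) t) =
      (\<Sum>n. \<gamma> * (\<gamma> ^ n * measure_pmf.expectation (chain_law \<sigma> K n) (\<lambda>s. pmf (K s) t)))"
    by (simp add: pmf_bind mult.assoc)
  also have "\<dots> = \<gamma> * (\<Sum>n. \<gamma> ^ n * measure_pmf.expectation (chain_law \<sigma> K n) (\<lambda>s. pmf (K s) t))"
    using summable_discounted_pmf[OF assms, of "\<lambda>n. chain_law \<sigma> K (Suc n)" t]
    by (intro suminf_mult) (simp add: pmf_bind)
  finally show ?thesis
    by (simp add: discounted_occ_def[of _ _ _ t] distrib_left mult.left_commute[of "1 - \<gamma>" \<gamma>]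
      discounted_expectation[OF assms])
qed

text \<open>The discounted flow operator is an \<open>l\<^sup>1\<close>-contraction.\<close>

lemma discounted_flow_unique:
  fixes K :: "'s::finite \<Rightarrow> 's pmf"
  assumes "0 \<le> \<gamma>" "\<gamma> < 1"
    and x: "\<And>t. x t = c t + \<gamma> * (\<Sum>s\<in>UNIV. x s * pmf (K s) t)"
    and y: "\<And>t. y t = c t + \<gamma> * (\<Sum>s\<in>UNIV. y s * pmf (K s) t)"
  shows "x = y"
proof -
  define z where "z t = x t - y t" for t
  have z: "z t = \<gamma> * (\<Sum>s\<in>UNIV. z s * pmf (K s) t)" for t
    using x[of t] y[of t] by (simp add: z_def left_diff_distrib sum_subtractf right_diff_distrib)
  have "(\<Sum>t\<in>UNIV. \<bar>z t\<bar>) \<le> (\<Sum>t\<in>UNIV. \<gamma> * (\<Sum>s\<in>UNIV. \<bar>z s\<bar> * pmf (K s) t))"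
  proof (rule sum_mono)
    fix t
    have "\<bar>\<Sum>s\<in>UNIV. z s * pmf (K s) t\<bar> \<le> (\<Sum>s\<in>UNIV. \<bar>z s\<bar> * pmf (K s) t)"
      by (rule order_trans[OF sum_abs]) (simp add: abs_mult)
    then show "\<bar>z t\<bar> \<le> \<gamma> * (\<Sum>s\<in>UNIV. \<bar>z s\<bar> * pmf (K s) t)"
      using assms(1) by (subst z) (simp add: abs_mult mult_left_mono)
  qed
  \<comment> \<open>After the swap the inner sums are total masses of \<open>K s\<close>, hence 1,
    and only the factor \<gamma> < 1 is left.\<close>
  also have "\<dots> = \<gamma> * (\<Sum>s\<in>UNIV. \<bar>z s\<bar> * (\<Sum>t\<in>UNIV. pmf (K s) t))"
    unfolding sum_distrib_left by (rule sum.swap)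
  also have "\<dots> = \<gamma> * (\<Sum>s\<in>UNIV. \<bar>z s\<bar>)"
    by (simp add: sum_pmf_eq_1)
  finally have "(1 - \<gamma>) * (\<Sum>t\<in>UNIV. \<bar>z t\<bar>) \<le> 0"
    by (simp add: left_diff_distrib)
  then have "(\<Sum>t\<in>UNIV. \<bar>z t\<bar>) \<le> 0"
    using assms(2) by (simp add: mult_le_0_iff)
  then have "(\<Sum>t\<in>UNIV. \<bar>z t\<bar>) = 0"
    by (intro antisym sum_nonneg) auto
  then have "z t = 0" for t
    by (simp add: sum_nonneg_eq_0_iff)
  then show ?thesis
    by (auto simp: z_def fun_eq_iff)
qed

text \<open>The Bellman equation is solved by the Neumann series of \<open>\<gamma> ^ n\<close>
  times the iterates of the averaging operator \<open>T\<close> on \<open>r\<close>. It converges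
  because averaging preserves the bound \<open>B\<close>.\<close>

lemma value_function_exists:
  fixes K :: "'s::finite \<Rightarrow> 's pmf" and r :: "'s \<Rightarrow> real"
  assumes "0 \<le> \<gamma>" "\<gamma> < 1"
  obtains V where "\<And>s. V s = r s + \<gamma> * (\<Sum>t\<in>UNIV. pmf (K s) t * V t)"
proof -
  define T where "T f s = (\<Sum>t\<in>UNIV. pmf (K s) t * f t)" for f :: "'s \<Rightarrow> real" and s
  define W where "W n = (T ^^ n) r" for n
  define V where "V s = (\<Sum>n. \<gamma> ^ n * W n s)" for s
  obtain B where B: "\<And>x. \<bar>r x\<bar> \<le> B" using bounded_finite_type by blast
  have W_bound: "\<bar>W n s\<bar> \<le> B" for n s
  proof (induction n arbitrary: s)
    case 0
    then show ?case by (simp add: W_def B)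
  next
    case (Suc n)
    have "\<bar>W (Suc n) s\<bar> \<le> (\<Sum>t\<in>UNIV. pmf (K s) t * \<bar>W n t\<bar>)"
      unfolding W_def funpow.simps comp_def T_def[of _ s]
      by (rule order_trans[OF sum_abs]) (simp add: abs_mult)
    also have "\<dots> \<le> (\<Sum>t\<in>UNIV. pmf (K s) t * B)"
      by (intro sum_mono mult_left_mono Suc.IH) simp
    also have "\<dots> = B"
      by (simp add: sum_distrib_right[symmetric] sum_pmf_eq_1)
    finally show ?case .
  qed
  have summ: "summable (\<lambda>n. \<gamma> ^ n * W n s)" for s
  proof (rule summable_comparison_test'[of "\<lambda>n. \<gamma> ^ n * B" 0])
    show "summable (\<lambda>n. \<gamma> ^ n * B)"
      using assms by (intro summable_mult2 summable_geometric) simp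
    show "norm (\<gamma> ^ n * W n s) \<le> \<gamma> ^ n * B" for n
      using assms W_bound[of n s] by (simp add: abs_mult mult_left_mono)
  qed
  have "V s = r s + \<gamma> * (\<Sum>t\<in>UNIV. pmf (K s) t * V t)" for s
  proof -
    have "V s = r s + (\<Sum>n. \<gamma> ^ Suc n * W (Suc n) s)"
      unfolding V_def using suminf_split_head[OF summ[of s]] by (simp add: W_def)
    also have "(\<Sum>n. \<gamma> ^ Suc n * W (Suc n) s) =
        (\<Sum>n. \<Sum>t\<in>UNIV. (\<gamma> * pmf (K s) t) * (\<gamma> ^ n * W n t))"
      by (simp add: W_def T_def[of _ s] sum_distrib_left mult_ac)
    also have "\<dots> = (\<Sum>t\<in>UNIV. (\<gamma> * pmf (K s) t) * V t)"
      unfolding V_def by (simp add: suminf_sum summable_mult summ suminf_mult)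
    finally show ?thesis
      by (simp add: sum_distrib_left mult.assoc)
  qed
  then show ?thesis by (rule that)
qed

text \<open>The flow equation tested against \<open>V\<close>: rewards of this form telescope along
  the chain, and only the initial distribution remains. This is what makes potential terms cancel
  when two policies are compared.\<close>

lemma discounted_flow_potential:
  fixes K :: "'s::finite \<Rightarrow> 's pmf" and V :: "'s \<Rightarrow> real"
  assumes "0 \<le> \<gamma>" "\<gamma> < 1"
  shows "(\<Sum>s\<in>UNIV. discounted_occ \<gamma> \<sigma> K s * (V s - \<gamma> * (\<Sum>t\<in>UNIV. pmf (K s) t * V t))) =
    (1 - \<gamma>) * (\<Sum>s\<in>UNIV. pmf \<sigma> s * V s)"
proof -
  let ?m = "discounted_occ \<gamma> \<sigma> K"
  have "(\<Sum>t\<in>UNIV. ?m t * V t) = (\<Sum>t\<in>UNIV. (1 - \<gamma>) * (pmf \<sigma> t * V t) +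
      \<gamma> * (\<Sum>s\<in>UNIV. ?m s * pmf (K s) t * V t))"
    by (subst discounted_occ_flow[OF assms])
      (simp add: distrib_right sum_distrib_right mult.assoc)
  also have "\<dots> = (1 - \<gamma>) * (\<Sum>s\<in>UNIV. pmf \<sigma> s * V s) +
      \<gamma> * (\<Sum>t\<in>UNIV. \<Sum>s\<in>UNIV. ?m s * pmf (K s) t * V t)"
    by (simp add: sum.distrib sum_distrib_left)
  also have "(\<Sum>t\<in>UNIV. \<Sum>s\<in>UNIV. ?m s * pmf (K s) t * V t) =
      (\<Sum>s\<in>UNIV. ?m s * (\<Sum>t\<in>UNIV. pmf (K s) t * V t))"
    by (subst sum.swap) (simp add: sum_distrib_left mult.assoc)
  finally show ?thesis
    by (simp add: right_diff_distrib sum_subtractf mult.left_commute[of _ \<gamma>]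
      sum_distrib_left[symmetric])
qed

section \<open>Occupancy and return of the MDP through its state chain\<close>

definition mean_reward ::
  "('s, 'a1::finite, 'a2::finite) mdp \<Rightarrow> 's \<Rightarrow> 'a1 pmf \<Rightarrow> 'a2 pmf \<Rightarrow> real" where
  "mean_reward M s p q = (\<Sum>a1\<in>UNIV. pmf p a1 * (\<Sum>a2\<in>UNIV. pmf q a2 * reward M s a1 a2))"

lemma occ_eq_discounted_occ:
  fixes M :: "('s::finite, 'a1::finite, 'a2::finite) mdp"
  assumes "0 \<le> discount M" "discount M < 1"
  shows "occ M \<pi>1 \<pi>2 = discounted_occ (discount M) (initial M) (state_step M \<pi>1 \<pi>2)"
proof
  fix s
  have ind: "measure_pmf.expectation (joint_law M \<pi>1 \<pi>2 n) (\<lambda>x. indicator {s} (fst x)) =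
      pmf (chain_law (initial M) (state_step M \<pi>1 \<pi>2) n) s" for n
  proof -
    have "measure_pmf.expectation (joint_law M \<pi>1 \<pi>2 n) (\<lambda>x. indicator {s} (fst x)) =
        measure_pmf.expectation (map_pmf fst (joint_law M \<pi>1 \<pi>2 n)) (indicator {s} :: _ \<Rightarrow> real)"
      by (rule integral_map_pmf[symmetric])
    also have "map_pmf fst (joint_law M \<pi>1 \<pi>2 n) = chain_law (initial M) (state_step M \<pi>1 \<pi>2) n"
      by (simp add: joint_law_def act_def map_bind_pmf pmf.map_comp comp_def bind_return_pmf')
    finally show ?thesis
      by (simp add: measure_pmf_single)
  qed
  show "occ M \<pi>1 \<pi>2 s = discounted_occ (discount M) (initial M) (state_step M \<pi>1 \<pi>2) s"
    unfolding occ_def discounted_occ_def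
      integral_discounted_trajectory[OF assms, where f = "\<lambda>x. indicator {s} (fst x)"] ind ..
qed

lemma rho_eq_sum_occ:
  fixes M :: "('s::finite, 'a1::finite, 'a2::finite) mdp"
  assumes "0 \<le> discount M" "discount M < 1"
  shows "rho M \<pi>1 \<pi>2 = (\<Sum>s\<in>UNIV. occ M \<pi>1 \<pi>2 s * mean_reward M s (\<pi>1 s) (\<pi>2 s))"
proof -
  have act: "measure_pmf.expectation (act \<pi>1 \<pi>2 s) (\<lambda>(s, a1, a2). reward M s a1 a2) =
      mean_reward M s (\<pi>1 s) (\<pi>2 s)" for s
    unfolding act_def integral_map_pmf
    unfolding expectation_finite mean_reward_def sum_distrib_left sum.cartesian_product
    by (rule sum.cong) (auto simp: pmf_pair)
  have "measure_pmf.expectation (joint_law M \<pi>1 \<pi>2 n) (\<lambda>(s, a1, a2). reward M s a1 a2) =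
      measure_pmf.expectation (chain_law (initial M) (state_step M \<pi>1 \<pi>2) n)
        (\<lambda>s. mean_reward M s (\<pi>1 s) (\<pi>2 s))" for n
    unfolding joint_law_def expectation_bind_finite act by (rule expectation_finite[symmetric])
  then show ?thesis
    unfolding rho_def occ_eq_discounted_occ[OF assms]
    by (simp add: integral_discounted_trajectory[OF assms, where f = "\<lambda>(s, a1, a2). reward M s a1 a2"]
      discounted_expectation[OF assms])
qed

section \<open>One-state deviations\<close>

text \<open>The draw of agent 1 has no influence on the next state and integrates out, so any fixed
  action \<open>b\<close> may stand in for it.\<close>

lemma pmf_state_step:
  fixes M :: "('s, 'a1::finite, 'a2::finite) mdp"
  assumes "\<And>s s' a1 a1' a2. pmf (transition M s a1 a2) s' = pmf (transition M s a1' a2) s'"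
  shows "state_step M \<pi>1 \<pi>2 s = bind_pmf (\<pi>2 s) (transition M s b)"
proof -
  have "transition M s = (\<lambda>_. transition M s b)"
    by (intro ext pmf_eqI assms)
  \<comment> \<open>A fresh name for the constant value; rewriting with the equation itself would
    loop, since \<open>transition M s\<close> recurs on its right-hand side.\<close>
  then obtain g where "transition M s = (\<lambda>_. g)" by (rule that)
  then show ?thesis
    by (simp add: state_step_def act_def bind_map_pmf case_prod_unfold pair_pmf_def bind_assoc_pmf
      bind_return_pmf)
qed

locale action_independent_mdp =
  fixes M :: "('s::finite, 'a1::finite, 'a2::finite) mdp"
  assumes discount: "0 \<le> discount M" "discount M < 1"
    and transition_indep:
      "\<And>s s' a1 a1' a2. pmf (transition M s a1 a2) s' = pmf (transition M s a1' a2) s'"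
begin

text \<open>Here \<open>undefined\<close> is an arbitrary action of agent 1; by
  \<open>transition_indep\<close> its choice is immaterial.\<close>

definition step2 :: "'s \<Rightarrow> 'a2 pmf \<Rightarrow> 's pmf" where
  "step2 s q = bind_pmf q (transition M s undefined)"

lemma occ_eq: "occ M \<pi>1 \<pi>2 = discounted_occ (discount M) (initial M) (\<lambda>s. step2 s (\<pi>2 s))"
  unfolding occ_eq_discounted_occ[OF discount] step2_def
  by (rule arg_cong[where f = "discounted_occ (discount M) (initial M)"])
    (rule ext, rule pmf_state_step[OF transition_indep])

text \<open>The source of all linearity below: changing the policy of agent 1 changes rewards but
  not the weights with which states are visited.\<close>

lemma occ_indep: "occ M \<pi>1 \<pi>2 = occ M \<pi>1' \<pi>2"
  by (simp add: occ_eq)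

lemma rho_eq: "rho M \<pi>1 \<pi>2 = (\<Sum>s\<in>UNIV. occ M \<pi>1 \<pi>2 s * mean_reward M s (\<pi>1 s) (\<pi>2 s))"
  by (rule rho_eq_sum_occ[OF discount])

lemma occ_nonneg: "occ M \<pi>1 \<pi>2 s \<ge> 0"
  unfolding occ_eq by (rule discounted_occ_nonneg[OF discount])

text \<open>\<open>A s q\<close> is the advantage of playing \<open>q\<close> in \<open>s\<close> once and \<open>\<pi>2\<close> afterwards.\<close>

lemma performance_difference:
  obtains A where "\<And>s. A s (\<pi>2 s) = 0"
    and "\<And>\<pi>2'. rho M \<pi>1 \<pi>2' - rho M \<pi>1 \<pi>2 = (\<Sum>s\<in>UNIV. occ M \<pi>1 \<pi>2' s * A s (\<pi>2' s))"
proof -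
  let ?r = "\<lambda>\<pi>2 s. mean_reward M s (\<pi>1 s) (\<pi>2 s)"
  obtain V where V: "\<And>s. V s = ?r \<pi>2 s + discount M * (\<Sum>t\<in>UNIV. pmf (step2 s (\<pi>2 s)) t * V t)"
    by (rule value_function_exists[OF discount, where r = "?r \<pi>2" and K = "\<lambda>s. step2 s (\<pi>2 s)"])
      (rule that)
  define A where
    "A s q = mean_reward M s (\<pi>1 s) q + discount M * (\<Sum>t\<in>UNIV. pmf (step2 s q) t * V t) - V s" for s q
  have A0: "A s (\<pi>2 s) = 0" for s
    using V[of s] by (simp add: A_def)
  \<comment> \<open>The potential part depends on \<open>V\<close> and the initial distribution
    only. It is common to all policies of agent 2 and drops out of differences.\<close>
  have rho_A: "rho M \<pi>1 \<pi>2' = (\<Sum>s\<in>UNIV. occ M \<pi>1 \<pi>2' s * A s (\<pi>2' s)) +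
      (1 - discount M) * (\<Sum>s\<in>UNIV. pmf (initial M) s * V s)" for \<pi>2'
    unfolding discounted_flow_potential[OF discount, symmetric, of _ _ "\<lambda>s. step2 s (\<pi>2' s)"]
      rho_eq sum.distrib[symmetric] occ_eq A_def
    by (simp add: algebra_simps)
  have "rho M \<pi>1 \<pi>2' - rho M \<pi>1 \<pi>2 = (\<Sum>s\<in>UNIV. occ M \<pi>1 \<pi>2' s * A s (\<pi>2' s))" for \<pi>2'
    unfolding rho_A[of \<pi>2'] rho_A[of \<pi>2] A0 by simp
  with A0 show ?thesis by (rule that)
qed

text \<open>Makes the denominators in \<open>chi_bar\<close> and \<open>chi_star\<close> positive,
  and allows the sign of an advantage to be read off from the return of a neighbor policy.\<close>

lemma occ_neighbor_pos:
  assumes "occ M \<pi>1 \<pi>2 s > 0"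
  shows "occ M \<pi>1 (neighbor \<pi>2 s a) s > 0"
proof (rule ccontr)
  let ?n = "neighbor \<pi>2 s a"
  let ?c = "\<lambda>t. (1 - discount M) * pmf (initial M) t"
  assume "\<not> ?thesis"
  then have 0: "occ M \<pi>1 ?n s = 0"
    using occ_nonneg[of \<pi>1 ?n s] by simp
  have flow: "occ M \<pi>1 \<pi> t = ?c t +
      discount M * (\<Sum>u\<in>UNIV. occ M \<pi>1 \<pi> u * pmf (step2 u (\<pi> u)) t)" for \<pi> t
    unfolding occ_eq by (rule discounted_occ_flow[OF discount])
  txt \<open>If the neighbor policy never visits \<open>s\<close>, it induces the same flow equation as \<open>\<pi>2\<close>.\<close>
  have "occ M \<pi>1 ?n = occ M \<pi>1 \<pi>2"
  proof (rule discounted_flow_unique[OF discount _ flow])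
    fix t
    have eq: "occ M \<pi>1 ?n u * pmf (step2 u (?n u)) t = occ M \<pi>1 ?n u * pmf (step2 u (\<pi>2 u)) t" for u
      using 0 by (cases "u = s") (simp_all add: neighbor_def)
    show "occ M \<pi>1 ?n t = ?c t +
        discount M * (\<Sum>u\<in>UNIV. occ M \<pi>1 ?n u * pmf (step2 u (\<pi>2 u)) t)"
      by (subst flow) (simp only: sum.cong[OF refl eq])
  qed
  with 0 assms show False by simp
qed

text \<open>
  If every one-state deviation from \<open>d\<close> loses at least \<open>\<epsilon>\<close>, then so does every deviation: as \<open>d\<close> is
  optimal, a policy that differs from \<open>d\<close> in several states does not lose by switching to \<open>d\<close> in a
  suitable one of them.
\<close>

lemma rho_neighbor_bound:
  assumes d: "deterministic d" and pos: "\<And>s. occ M \<pi>1 d s > 0" and "\<epsilon> \<ge> 0"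
    and nbr: "\<And>s a. pmf (d s) a = 0 \<Longrightarrow> rho M \<pi>1 (neighbor d s a) + \<epsilon> \<le> rho M \<pi>1 d"
    and \<pi>: "deterministic \<pi>" "\<pi> \<noteq> d"
  shows "rho M \<pi>1 \<pi> + \<epsilon> \<le> rho M \<pi>1 d"
proof -
  have off: "pmf (d s) a = 0" if "return_pmf a \<noteq> d s" for s a
  proof -
    obtain b where "d s = return_pmf b" using d by (auto simp: deterministic_def)
    with that show ?thesis by auto
  qed
  have optimal: "rho M \<pi>1 \<pi>' \<le> rho M \<pi>1 d" if \<pi>': "deterministic \<pi>'" for \<pi>'
  proof -
    obtain A where A0: "\<And>s. A s (d s) = 0"
      and A: "\<And>\<pi>2'. rho M \<pi>1 \<pi>2' - rho M \<pi>1 d = (\<Sum>s\<in>UNIV. occ M \<pi>1 \<pi>2' s * A s (\<pi>2' s))"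
      using performance_difference by blast
    \<comment> \<open>A neighbor of \<open>d\<close> isolates one advantage: all other summands
      vanish by \<open>A0\<close>, and the remaining one carries a positive occupancy.\<close>
    have le: "A s (return_pmf a) \<le> 0" for s a
    proof (cases "return_pmf a = d s")
      case True
      then show ?thesis by (simp add: A0)
    next
      case False
      have "rho M \<pi>1 (neighbor d s a) - rho M \<pi>1 d =
          (\<Sum>t\<in>UNIV. if t = s then occ M \<pi>1 (neighbor d s a) s * A s (return_pmf a) else 0)"
        unfolding A by (rule sum.cong) (auto simp: neighbor_def A0)
      then have "occ M \<pi>1 (neighbor d s a) s * A s (return_pmf a) \<le> 0"
        using nbr[OF off[OF False]] \<open>\<epsilon> \<ge> 0\<close> by simp
      then show ?thesis
        using occ_neighbor_pos[OF pos, of s a] by (simp add: mult_le_0_iff)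
    qed
    have "(\<Sum>s\<in>UNIV. occ M \<pi>1 \<pi>' s * A s (\<pi>' s)) \<le> 0"
    proof (intro sum_nonpos mult_nonneg_nonpos occ_nonneg)
      show "A s (\<pi>' s) \<le> 0" for s
      proof -
        obtain a where "\<pi>' s = return_pmf a" using \<pi>' by (auto simp: deterministic_def)
        with le[of s a] show ?thesis by simp
      qed
    qed
    then show ?thesis using A[of \<pi>'] by simp
  qed
  show ?thesis
    using \<pi>
  \<comment> \<open>Induction on the number of states in which the policy disagrees with
    \<open>d\<close>.\<close>
  proof (induction "card {s. \<pi> s \<noteq> d s}" arbitrary: \<pi> rule: less_induct)
    case less
    let ?D = "{s. \<pi> s \<noteq> d s}"
    \<comment> \<open>The roles are now exchanged: advantages are relative to \<pi>, and
      \<open>d\<close> is the competitor.\<close>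
    obtain A where A0: "\<And>s. A s (\<pi> s) = 0"
      and A: "\<And>\<pi>2'. rho M \<pi>1 \<pi>2' - rho M \<pi>1 \<pi> = (\<Sum>s\<in>UNIV. occ M \<pi>1 \<pi>2' s * A s (\<pi>2' s))"
      using performance_difference by blast
    \<comment> \<open>If switching to \<open>d\<close> were strictly bad at every state of
      disagreement, then \<open>d\<close>, which visits all states, would earn strictly less than
      \<pi>, against \<open>optimal\<close>.\<close>
    have "\<exists>s\<in>?D. A s (d s) \<ge> 0"
    proof (rule ccontr)
      assume "\<not> ?thesis"
      then have neg: "A s (d s) < 0" if "\<pi> s \<noteq> d s" for s using that by (auto simp: not_le)
      obtain u where u: "\<pi> u \<noteq> d u" using less.prems by (auto simp: fun_eq_iff)
      have "(\<Sum>s\<in>UNIV. occ M \<pi>1 d s * A s (d s)) < (\<Sum>s\<in>(UNIV :: 's set). 0)"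
      proof (rule sum_strict_mono_ex1)
        have "A s (d s) \<le> 0" for s using neg[of s] A0[of s] by (cases "\<pi> s = d s") auto
        then show "\<forall>s\<in>UNIV. occ M \<pi>1 d s * A s (d s) \<le> 0"
          by (auto intro: mult_nonneg_nonpos occ_nonneg)
        show "\<exists>s\<in>UNIV. occ M \<pi>1 d s * A s (d s) < 0"
          using mult_pos_neg[OF pos neg[OF u]] by blast
      qed simp
      then show False using A[of d] optimal[OF less.prems(1)] by simp
    qed
    then obtain s where s: "\<pi> s \<noteq> d s" "A s (d s) \<ge> 0" by auto
    let ?\<pi>' = "\<pi>(s := d s)"
    have det': "deterministic ?\<pi>'"
      using d less.prems(1) by (simp add: deterministic_def)
    show ?case
    proof (cases "?\<pi>' = d")
      \<comment> \<open>Only one disagreement was left, so \<pi> is itself a neighbor of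
        \<open>d\<close>.\<close>
      case True
      obtain a where a: "\<pi> s = return_pmf a" using less.prems(1) by (auto simp: deterministic_def)
      have "neighbor d s a = ?\<pi>'(s := \<pi> s)"
        unfolding True neighbor_def a ..
      then have "neighbor d s a = \<pi>" by simp
      moreover have "return_pmf a \<noteq> d s" using s(1) a by simp
      ultimately show ?thesis using nbr[of s a] off[of a s] by simp
    next
      case False
      have "{t. ?\<pi>' t \<noteq> d t} \<subset> ?D" using s(1) by auto
      then have "card {t. ?\<pi>' t \<noteq> d t} < card ?D" by (intro psubset_card_mono) auto
      then have "rho M \<pi>1 ?\<pi>' + \<epsilon> \<le> rho M \<pi>1 d" using less.hyps det' False by blast
      moreover have "rho M \<pi>1 ?\<pi>' - rho M \<pi>1 \<pi> \<ge> 0"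
        unfolding A by (intro sum_nonneg mult_nonneg_nonneg occ_nonneg) (use s(2) A0 in auto)
      ultimately show ?thesis by simp
    qed
  qed
qed

text \<open>As \<open>d\<close> visits every state, \<open>target_class\<close> is the singleton of
  \<open>d\<close>. The attack constraints thus reduce to one-state deviations, which are linear in
  the policy of agent 1.\<close>

lemma attack_feasible_iff:
  assumes d: "deterministic d" and pos: "\<And>\<pi>1 s. occ M \<pi>1 d s > 0" and "\<epsilon> \<ge> 0"
  shows "attack_feasible M d \<epsilon> \<pi>1 \<longleftrightarrow> (\<forall>s a. pmf (d s) a = 0 \<longrightarrow> \<epsilon> \<le> alpha M d \<pi>1 s a)"
proof
  assume *: "\<forall>s a. pmf (d s) a = 0 \<longrightarrow> \<epsilon> \<le> alpha M d \<pi>1 s a"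
  show "attack_feasible M d \<epsilon> \<pi>1"
    unfolding attack_feasible_def
  proof
    fix \<pi> assume "\<pi> \<in> Collect deterministic - target_class M d \<pi>1"
    then have "deterministic \<pi>" "\<pi> \<noteq> d" by (auto simp: target_class_def)
    moreover have "rho M \<pi>1 (neighbor d s a) + \<epsilon> \<le> rho M \<pi>1 d" if "pmf (d s) a = 0" for s a
      using *[rule_format, OF that] by (simp add: alpha_def)
    ultimately show "rho M \<pi>1 \<pi> + \<epsilon> \<le> rho M \<pi>1 d"
      using rho_neighbor_bound[OF d pos \<open>\<epsilon> \<ge> 0\<close>, of \<pi>1 \<pi>] by simp
  qed
next
  assume *: "attack_feasible M d \<epsilon> \<pi>1"
  show "\<forall>s a. pmf (d s) a = 0 \<longrightarrow> \<epsilon> \<le> alpha M d \<pi>1 s a"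
  proof (intro allI impI)
    fix s a assume a: "pmf (d s) a = 0"
    then have "d s \<noteq> return_pmf a" by auto
    then have "neighbor d s a \<notin> target_class M d \<pi>1"
      using pos[of \<pi>1 s] by (auto simp: target_class_def neighbor_def intro!: exI[of _ s])
    moreover have "deterministic (neighbor d s a)"
      using d by (auto simp: deterministic_def neighbor_def)
    ultimately show "\<epsilon> \<le> alpha M d \<pi>1 s a"
      using *[unfolded attack_feasible_def, rule_format, of "neighbor d s a"]
      by (simp add: alpha_def)
  qed
qed

end

section \<open>The space of policies\<close>

text \<open>Places policies in a Euclidean space, where closed bounded sets are compact.\<close>

definition policy_vec :: "('s::finite, 'a::finite) policy \<Rightarrow> real ^ ('s \<times> 'a)" where
  "policy_vec \<pi> = (\<chi> i. pmf (\<pi> (fst i)) (snd i))"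

lemma policy_vec_nth [simp]: "policy_vec \<pi> $ (s, a) = pmf (\<pi> s) a"
  by (simp add: policy_vec_def)

text \<open>The image is a product of probability simplices, described by closed conditions;
  \<open>embed_pmf\<close> turns each row back into a distribution.\<close>

lemma range_policy_vec:
  "range (policy_vec :: ('s::finite, 'a::finite) policy \<Rightarrow> _) =
    {x. (\<forall>i. 0 \<le> x $ i) \<and> (\<forall>s. (\<Sum>a\<in>UNIV. x $ (s, a)) = 1)}"
proof (intro equalityI subsetI)
  fix x :: "real ^ ('s \<times> 'a)"
  assume x: "x \<in> {x. (\<forall>i. 0 \<le> x $ i) \<and> (\<forall>s. (\<Sum>a\<in>UNIV. x $ (s, a)) = 1)}"
  have "pmf (embed_pmf (\<lambda>a. x $ (s, a))) a = x $ (s, a)" for s a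
  proof (rule pmf_embed_pmf)
    show "(\<integral>\<^sup>+a. ennreal (x $ (s, a)) \<partial>count_space UNIV) = 1"
      using x by (simp add: nn_integral_count_space_finite sum_ennreal)
  qed (use x in simp)
  then have "policy_vec (\<lambda>s. embed_pmf (\<lambda>a. x $ (s, a))) = x"
    by (simp add: policy_vec_def vec_eq_iff)
  then show "x \<in> range policy_vec" by (metis rangeI)
qed (auto simp: policy_vec_def sum_pmf_eq_1)

lemma compact_range_policy_vec:
  "compact (range (policy_vec :: ('s::finite, 'a::finite) policy \<Rightarrow> _))"
proof (rule compact_eq_bounded_closed[THEN iffD2], intro conjI)
  have "norm (policy_vec \<pi>) \<le> real CARD('s \<times> 'a)" for \<pi> :: "('s, 'a) policy"
  proof -
    have "norm (policy_vec \<pi>) \<le> (\<Sum>i\<in>UNIV. \<bar>policy_vec \<pi> $ i\<bar>)"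
      by (rule norm_le_l1_cart)
    also have "\<dots> \<le> (\<Sum>i\<in>(UNIV :: ('s \<times> 'a) set). 1)"
      by (rule sum_mono) (simp add: policy_vec_def pmf_le_1)
    finally show ?thesis by simp
  qed
  then show "bounded (range (policy_vec :: ('s, 'a) policy \<Rightarrow> _))"
    unfolding bounded_iff by blast
  show "closed (range (policy_vec :: ('s, 'a) policy \<Rightarrow> _))"
    unfolding range_policy_vec
    by (intro closed_Collect_conj closed_Collect_all closed_Collect_le closed_Collect_eq
      continuous_intros)
qed

lemma continuous_on_Min:
  fixes f :: "'i \<Rightarrow> 'a::topological_space \<Rightarrow> real"
  assumes "finite I" "I \<noteq> {}" "\<And>i. i \<in> I \<Longrightarrow> continuous_on S (f i)"
  shows "continuous_on S (\<lambda>x. Min ((\<lambda>i. f i x) ` I))"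
  using assms by (induction rule: finite_ne_induct) (auto intro!: continuous_on_min)

lemma cost_eq_policy_vec:
  "cost p \<pi> \<pi>0 = (\<Sum>s\<in>UNIV. (\<Sum>a\<in>UNIV. \<bar>policy_vec \<pi> $ (s, a) - pmf (\<pi>0 s) a\<bar>) powr p) powr (1 / p)"
  by (simp add: cost_def)

text \<open>The bases of \<open>powr\<close> may vanish, for instance at \<pi>0 itself; continuity
  there rests on nonnegative bases and positive exponents.\<close>

lemma continuous_on_cost:
  fixes \<pi>0 :: "('s::finite, 'a::finite) policy"
  assumes "p > 0"
  shows "continuous_on S (\<lambda>x :: real ^ ('s \<times> 'a).
    (\<Sum>s\<in>UNIV. (\<Sum>a\<in>UNIV. \<bar>x $ (s, a) - pmf (\<pi>0 s) a\<bar>) powr p) powr (1 / p))"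
  using assms by (intro continuous_on_powr' continuous_intros) (auto intro!: sum_nonneg)

section \<open>Mixtures of two policies and their cost\<close>

definition mix_policy :: "real \<Rightarrow> ('s, 'a) policy \<Rightarrow> ('s, 'a) policy \<Rightarrow> ('s, 'a) policy" where
  "mix_policy l \<pi> \<pi>' s = bind_pmf (bernoulli_pmf l) (\<lambda>b. if b then \<pi>' s else \<pi> s)"

lemma pmf_mix_policy:
  assumes "0 \<le> l" "l \<le> 1"
  shows "pmf (mix_policy l \<pi> \<pi>' s) a = (1 - l) * pmf (\<pi> s) a + l * pmf (\<pi>' s) a"
  using assms by (simp add: mix_policy_def pmf_bind)

text \<open>Two distributions are at \<open>l^1\<close>-distance at most 2, and mixing with weight
  \<open>l\<close> scales this by \<open>l\<close>. The same bound in every state gives the factor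
  \<open>CARD('s) powr (1 / p)\<close>.\<close>

lemma cost_mix_policy_le:
  fixes \<pi> \<pi>' :: "('s::finite, 'a::finite) policy"
  assumes l: "0 \<le> l" "l \<le> 1" and p: "p \<ge> 1"
  shows "cost p (mix_policy l \<pi> \<pi>') \<pi> \<le> 2 * l * real CARD('s) powr (1 / p)"
proof -
  have "(\<Sum>a\<in>UNIV. \<bar>pmf (mix_policy l \<pi> \<pi>' s) a - pmf (\<pi> s) a\<bar>) \<le> 2 * l" for s
  proof -
    have "(\<Sum>a\<in>UNIV. \<bar>pmf (mix_policy l \<pi> \<pi>' s) a - pmf (\<pi> s) a\<bar>) =
        (\<Sum>a\<in>UNIV. l * \<bar>pmf (\<pi>' s) a - pmf (\<pi> s) a\<bar>)"
    proof (rule sum.cong)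
      fix a
      have "pmf (mix_policy l \<pi> \<pi>' s) a - pmf (\<pi> s) a = l * (pmf (\<pi>' s) a - pmf (\<pi> s) a)"
        by (simp add: pmf_mix_policy[OF l] algebra_simps)
      then show "\<bar>pmf (mix_policy l \<pi> \<pi>' s) a - pmf (\<pi> s) a\<bar> = l * \<bar>pmf (\<pi>' s) a - pmf (\<pi> s) a\<bar>"
        using l by (simp add: abs_mult)
    qed simp
    also have "\<dots> \<le> (\<Sum>a\<in>UNIV. l * (pmf (\<pi>' s) a + pmf (\<pi> s) a))"
      using l by (intro sum_mono mult_left_mono) (auto simp: abs_le_iff add_increasing add_increasing2)
    also have "\<dots> = 2 * l"
      by (simp add: sum_distrib_left[symmetric] sum.distrib sum_pmf_eq_1)
    finally show ?thesis .
  qed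
  then have "(\<Sum>s\<in>UNIV. (\<Sum>a\<in>UNIV. \<bar>pmf (mix_policy l \<pi> \<pi>' s) a - pmf (\<pi> s) a\<bar>) powr p) \<le>
      (\<Sum>s\<in>(UNIV :: 's set). (2 * l) powr p)"
    using p by (intro sum_mono powr_mono2) (auto intro!: sum_nonneg)
  then have "cost p (mix_policy l \<pi> \<pi>') \<pi> \<le> (real CARD('s) * (2 * l) powr p) powr (1 / p)"
    unfolding cost_def using p by (intro powr_mono2) (auto intro!: sum_nonneg)
  also have "\<dots> = real CARD('s) powr (1 / p) * (2 * l)"
    using l p by (simp add: powr_mult powr_powr)
  finally show ?thesis by (simp add: mult_ac)
qed

lemma sup_norm_ge: "\<bar>f s a\<bar> \<le> sup_norm f"
  unfolding sup_norm_def by (rule Max_ge) (auto intro!: image_eqI[of _ _ "(s, a)"])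

lemma sup_norm_le:
  assumes "\<And>s a. \<bar>f s a\<bar> \<le> B"
  shows "sup_norm f \<le> B"
  unfolding sup_norm_def using assms by (subst Max_le_iff) auto

section \<open>Cost of an optimal attack\<close>

context action_independent_mdp
begin

text \<open>By \<open>occ_indep\<close> the occupancies are constants here, so agent 1 enters only
  through the mean rewards, linearly. Both mixing and continuity of \<open>alpha\<close>
  follow.\<close>

lemma alpha_linear:
  obtains c where "\<And>\<pi>1. alpha M d \<pi>1 s a = (\<Sum>t\<in>UNIV. \<Sum>b\<in>UNIV. pmf (\<pi>1 t) b * c t b)"
proof -
  define r where "r \<pi>2 t b =
    occ M undefined \<pi>2 t * (\<Sum>a2\<in>UNIV. pmf (\<pi>2 t) a2 * reward M t b a2)" for \<pi>2 t b
  have "rho M \<pi>1 \<pi>2 = (\<Sum>t\<in>UNIV. \<Sum>b\<in>UNIV. pmf (\<pi>1 t) b * r \<pi>2 t b)" for \<pi>1 \<pi>2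
    unfolding rho_eq occ_indep[of \<pi>1 \<pi>2 undefined]
    by (simp add: r_def mean_reward_def sum_distrib_left mult_ac)
  then have "alpha M d \<pi>1 s a = (\<Sum>t\<in>UNIV. \<Sum>b\<in>UNIV. pmf (\<pi>1 t) b * (r d t b - r (neighbor d s a) t b))"
    for \<pi>1
    by (simp add: alpha_def right_diff_distrib sum_subtractf)
  then show ?thesis by (rule that)
qed

lemma alpha_mix_policy:
  assumes "0 \<le> l" "l \<le> 1"
  shows "alpha M d (mix_policy l \<pi> \<pi>') s a = (1 - l) * alpha M d \<pi> s a + l * alpha M d \<pi>' s a"
proof -
  obtain c where c: "\<And>\<pi>1. alpha M d \<pi>1 s a = (\<Sum>t\<in>UNIV. \<Sum>b\<in>UNIV. pmf (\<pi>1 t) b * c t b)"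
    by (rule alpha_linear[of d s a]) (rule that)
  show ?thesis
    by (simp add: c pmf_mix_policy[OF assms] distrib_right sum.distrib sum_distrib_left mult.assoc)
qed

lemma alpha_continuous:
  obtains g where "continuous_on UNIV g" "\<And>\<pi>1. alpha M d \<pi>1 s a = g (policy_vec \<pi>1)"
proof -
  obtain c where c: "\<And>\<pi>1. alpha M d \<pi>1 s a = (\<Sum>t\<in>UNIV. \<Sum>b\<in>UNIV. pmf (\<pi>1 t) b * c t b)"
    by (rule alpha_linear[of d s a]) (rule that)
  show ?thesis
  proof (rule that)
    show "continuous_on UNIV (\<lambda>x :: real ^ ('s \<times> 'a1). \<Sum>t\<in>UNIV. \<Sum>b\<in>UNIV. x $ (t, b) * c t b)"
      by (intro continuous_intros)
  qed (simp add: c)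
qed

lemma alpha_min_le: "pmf (d s) a = 0 \<Longrightarrow> alpha_min M d \<pi>1 \<le> ereal (alpha M d \<pi>1 s a)"
  unfolding alpha_min_def by (rule INF_lower2[of "(s, a)"]) auto

text \<open>A supremum of at least \<epsilon> need not give a policy reaching \<epsilon>;
  compactness of the policy space and continuity of the minimum do.\<close>

lemma alpha_star_attained:
  assumes "alpha_star M d \<ge> ereal \<epsilon>"
  obtains \<pi>1 where "\<And>s a. pmf (d s) a = 0 \<Longrightarrow> \<epsilon> \<le> alpha M d \<pi>1 s a"
\<comment> \<open>Without off-target pairs \<open>alpha_star\<close> is infinite and every policy
  qualifies; otherwise the minimum is over a nonempty finite set and is real.\<close>
proof (cases "\<exists>s a. pmf (d s) a = 0")
  case False
  then show ?thesis using that by blast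
next
  case True
  define I where "I = {(s, a). pmf (d s) a = 0}"
  have "\<forall>i. \<exists>g. continuous_on UNIV g \<and> (\<forall>\<pi>1. alpha M d \<pi>1 (fst i) (snd i) = g (policy_vec \<pi>1))"
    using alpha_continuous by metis
  then obtain g where g: "\<And>i. continuous_on UNIV (g i)"
    and alpha_g: "\<And>\<pi>1 s a. alpha M d \<pi>1 s a = g (s, a) (policy_vec \<pi>1)"
    by (metis fst_conv snd_conv)
  let ?m = "\<lambda>x. Min ((\<lambda>i. g i x) ` I)"
  have I: "finite I" "I \<noteq> {}"
    using True by (auto simp: I_def)
  have "continuous_on (range policy_vec) ?m"
    by (intro continuous_on_Min I continuous_on_subset[OF g]) auto
  then obtain x where "x \<in> range policy_vec" and x: "\<forall>y\<in>range policy_vec. ?m y \<le> ?m x"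
    using continuous_attains_sup[OF compact_range_policy_vec] by (metis UNIV_not_empty image_is_empty)
  then obtain \<pi> where \<pi>: "x = policy_vec \<pi>" by blast
  have "alpha_star M d \<le> ereal (?m x)"
    unfolding alpha_star_def
  proof (rule SUP_least)
    fix \<pi>'
    have "?m (policy_vec \<pi>') \<in> (\<lambda>i. g i (policy_vec \<pi>')) ` I"
      using I by (intro Min_in) auto
    then obtain s a where sa: "pmf (d s) a = 0" "?m (policy_vec \<pi>') = g (s, a) (policy_vec \<pi>')"
      by (auto simp: I_def)
    have "alpha_min M d \<pi>' \<le> ereal (?m (policy_vec \<pi>'))"
      using alpha_min_le[of d s a, OF sa(1)] by (simp add: sa(2) alpha_g)
    also have "\<dots> \<le> ereal (?m x)"
      using x by simp
    finally show "alpha_min M d \<pi>' \<le> ereal (?m x)" .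
  qed
  then have "\<epsilon> \<le> ?m x"
    using assms by (metis ereal_less_eq(3) order_trans)
  moreover have "?m x \<le> alpha M d \<pi> s a" if "pmf (d s) a = 0" for s a
    unfolding alpha_g \<pi> using I that by (intro Min_le) (auto simp: I_def)
  ultimately show ?thesis
    using that by (meson order_trans)
qed

text \<open>The feasible vectors form a nonempty closed part of a compact set, on which the
  continuous cost attains its infimum.\<close>

lemma attack_optimal_exists:
  assumes d: "deterministic d" and pos: "\<And>\<pi>1 s. occ M \<pi>1 d s > 0" and "\<epsilon> \<ge> 0" and p: "p \<ge> 1"
    and feas: "attack_feasible M d \<epsilon> \<pi>f"
  shows "\<exists>\<pi>1. attack_optimal M d \<epsilon> p \<pi>0 \<pi>1"
proof -
  let ?F = "Collect (attack_feasible M d \<epsilon>)"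
  let ?c = "\<lambda>x :: real ^ ('s \<times> 'a1).
    (\<Sum>s\<in>UNIV. (\<Sum>a\<in>UNIV. \<bar>x $ (s, a) - pmf (\<pi>0 s) a\<bar>) powr p) powr (1 / p)"
  have "\<forall>i. \<exists>g. continuous_on UNIV g \<and> (\<forall>\<pi>1. alpha M d \<pi>1 (fst i) (snd i) = g (policy_vec \<pi>1))"
    using alpha_continuous by metis
  then obtain g where g: "\<And>i. continuous_on UNIV (g i)"
    and alpha_g: "\<And>\<pi>1 s a. alpha M d \<pi>1 s a = g (s, a) (policy_vec \<pi>1)"
    by (metis fst_conv snd_conv)
  have "policy_vec ` ?F = range policy_vec \<inter> {x. \<forall>s a. pmf (d s) a = 0 \<longrightarrow> \<epsilon> \<le> g (s, a) x}"
    by (auto simp: attack_feasible_iff[OF d pos \<open>\<epsilon> \<ge> 0\<close>] alpha_g)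
  moreover have "closed {x. \<forall>s a. pmf (d s) a = 0 \<longrightarrow> \<epsilon> \<le> g (s, a) x}"
    by (intro closed_Collect_all closed_Collect_imp closed_Collect_le continuous_on_const g) simp
  ultimately have "compact (policy_vec ` ?F)"
    by (simp add: compact_Int_closed compact_range_policy_vec)
  moreover have "policy_vec ` ?F \<noteq> {}"
    using feas by auto
  moreover have "continuous_on (policy_vec ` ?F) ?c"
    using p by (intro continuous_on_cost) simp
  ultimately obtain x where "x \<in> policy_vec ` ?F" and x: "\<forall>y\<in>policy_vec ` ?F. ?c x \<le> ?c y"
    using continuous_attains_inf by blast
  then obtain \<pi> where \<pi>: "attack_feasible M d \<epsilon> \<pi>" "x = policy_vec \<pi>" by blast
  have "cost p \<pi> \<pi>0 \<le> cost p \<pi>' \<pi>0" if "attack_feasible M d \<epsilon> \<pi>'" for \<pi>'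
    using x that unfolding \<pi>(2) cost_eq_policy_vec by blast
  with \<pi>(1) show ?thesis
    by (force simp: attack_optimal_def is_arg_min_def not_less)
qed

lemma cost_bound:
  assumes d: "deterministic d" and pos: "\<And>\<pi>1 s. occ M \<pi>1 d s > 0" and "\<epsilon> \<ge> 0" and p: "p \<ge> 1"
    and star: "\<And>s a. pmf (d s) a = 0 \<Longrightarrow> \<epsilon> \<le> alpha M d \<pi>star s a"
    and opt: "attack_optimal M d \<epsilon> p \<pi>0 \<pi>1"
  shows "cost p \<pi>1 \<pi>0 \<le> 2 * sup_norm (chi_ratio M d \<epsilon> \<pi>0 \<pi>star) * real CARD('s) powr (1 / p)"
proof -
  let ?cb = "chi_bar M d \<epsilon> \<pi>0" and ?cs = "chi_star M d \<epsilon> \<pi>0 \<pi>star"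
  let ?ratio = "chi_ratio M d \<epsilon> \<pi>0 \<pi>star"
  define l where "l = sup_norm ?ratio"
  have m: "occ M \<pi>0 (neighbor d s a) s > 0" for s a
    by (rule occ_neighbor_pos) (rule pos)
  have cb: "?cb s a \<ge> 0" for s a
    by (simp add: chi_bar_def)
  have cs: "?cs s a \<ge> 0" if "pmf (d s) a = 0" for s a
    using star[OF that] m[of s a] by (simp add: chi_star_def)
  \<comment> \<open>Off target both summands of the denominator are nonnegative; on target
    \<open>chi_bar\<close> vanishes. Hence \<open>l\<close> is a legitimate mixing weight.\<close>
  have "\<bar>?ratio s a\<bar> \<le> 1" for s a
  proof (cases "pmf (d s) a = 0")
    case True
    then show ?thesis
      using cb[of s a] cs[of s a] by (simp add: chi_ratio_def divide_le_eq)
  next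
    case False
    then have "?cb s a = 0" by (simp add: chi_bar_def)
    then show ?thesis by (simp add: chi_ratio_def)
  qed
  then have l1: "l \<le> 1"
    unfolding l_def by (rule sup_norm_le)
  have l0: "0 \<le> l"
    unfolding l_def using sup_norm_ge[of ?ratio undefined undefined] by linarith
  have "\<epsilon> \<le> alpha M d (mix_policy l \<pi>0 \<pi>star) s a" if sa: "pmf (d s) a = 0" for s a
  proof (cases "?cb s a = 0")
    \<comment> \<open>Here \<pi>0 already meets the constraint, as does \<open>\<pi>star\<close>,
      and so does every mixture.\<close>
    case True
    then have "\<epsilon> \<le> alpha M d \<pi>0 s a"
      using m[of s a] pos sa by (auto simp: chi_bar_def max_def alpha_def divide_le_0_iff zero_le_divide_iff split: if_splits)
    then have "(1 - l) * \<epsilon> + l * \<epsilon> \<le> (1 - l) * alpha M d \<pi>0 s a + l * alpha M d \<pi>star s a"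
      using l0 l1 star[OF sa] by (intro add_mono mult_left_mono) auto
    then show ?thesis
      by (simp add: alpha_mix_policy[OF l0 l1] algebra_simps)
  next
    \<comment> \<open>With \<open>?m\<close> the common denominator, \<pi>0 misses the constraint by
      \<open>?cb s a * ?m\<close> and \<open>\<pi>star\<close> exceeds it by
      \<open>?cs s a * ?m\<close>. The mixture succeeds once
      \<open>(1 - l) * ?cb s a \<le> l * ?cs s a\<close>, which holds as \<open>l\<close> is at
      least the ratio.\<close>
    case False
    let ?m = "occ M \<pi>0 (neighbor d s a) s"
    have gap0: "?cb s a * ?m = \<epsilon> - alpha M d \<pi>0 s a"
      using False m[of s a] pos sa by (auto simp: chi_bar_def max_def alpha_def split: if_splits)
    have gap1: "?cs s a * ?m = alpha M d \<pi>star s a - \<epsilon>"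
      using m[of s a] by (simp add: chi_star_def)
    have "?cb s a / (?cs s a + ?cb s a) \<le> l"
      using False sup_norm_ge[of ?ratio s a] cb[of s a] cs[OF sa] by (simp add: l_def chi_ratio_def)
    then have "?cb s a \<le> l * (?cs s a + ?cb s a)"
      using False cb[of s a] cs[OF sa] by (simp add: divide_le_eq)
    then have "?cb s a * ?m \<le> l * (?cs s a + ?cb s a) * ?m"
      using m[of s a] by (intro mult_right_mono) simp_all
    also have "\<dots> = l * (?cs s a * ?m + ?cb s a * ?m)"
      by (simp add: algebra_simps)
    finally show ?thesis
      unfolding gap0 gap1 alpha_mix_policy[OF l0 l1] by (simp add: algebra_simps)
  qed
  then have "attack_feasible M d \<epsilon> (mix_policy l \<pi>0 \<pi>star)"
    using attack_feasible_iff[OF d pos \<open>\<epsilon> \<ge> 0\<close>] by blast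
  then have "cost p \<pi>1 \<pi>0 \<le> cost p (mix_policy l \<pi>0 \<pi>star) \<pi>0"
    using opt by (auto simp: attack_optimal_def is_arg_min_def not_less)
  also have "\<dots> \<le> 2 * l * real CARD('s) powr (1 / p)"
    by (rule cost_mix_policy_le[OF l0 l1 p])
  finally show ?thesis
    by (simp add: l_def)
qed

end

text \<open>The bound covers every maximizer and every optimal attack; existence of an optimal
  attack is a separate conjunct, as feasibility alone does not provide one.\<close>

theorem theorem3:
  fixes M :: "('s::finite, 'a1::finite, 'a2::finite) mdp"
    and \<pi>0 :: "('s, 'a1) policy" and d :: "('s, 'a2) policy" and \<epsilon> p :: real
  assumes "0 \<le> discount M" and "discount M < 1"
    and "deterministic d"
    and "\<epsilon> \<ge> 0" and "p \<ge> 1"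
    and "\<And>s s' a1 a1' a2. pmf (transition M s a1 a2) s' = pmf (transition M s a1' a2) s'"
    and "\<And>\<pi>1 s. occ M \<pi>1 d s > 0"
    and "alpha_star M d \<ge> ereal \<epsilon>"
  shows "(\<exists>\<pi>1. attack_feasible M d \<epsilon> \<pi>1)
    \<and> (\<exists>\<pi>1. attack_optimal M d \<epsilon> p \<pi>0 \<pi>1)
    \<and> (\<forall>\<pi>star \<pi>1. attains_alpha_star M d \<pi>star \<longrightarrow> attack_optimal M d \<epsilon> p \<pi>0 \<pi>1 \<longrightarrow>
        cost p \<pi>1 \<pi>0 \<le> 2 * sup_norm (chi_ratio M d \<epsilon> \<pi>0 \<pi>star) * real CARD('s) powr (1 / p))"
proof -
  interpret action_independent_mdp M
    using assms(1,2,6) by unfold_locales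
  obtain \<pi>f where "\<And>s a. pmf (d s) a = 0 \<Longrightarrow> \<epsilon> \<le> alpha M d \<pi>f s a"
    by (rule alpha_star_attained[OF assms(8)]) (rule that)
  then have feas: "attack_feasible M d \<epsilon> \<pi>f"
    using attack_feasible_iff[OF assms(3,7,4)] by blast
  have star: "\<epsilon> \<le> alpha M d \<pi>star s a"
    if "attains_alpha_star M d \<pi>star" "pmf (d s) a = 0" for \<pi>star s a
  proof -
    have "ereal \<epsilon> \<le> ereal (alpha M d \<pi>star s a)"
      using assms(8) alpha_min_le[of d s a, OF that(2), of \<pi>star] that(1)
      unfolding attains_alpha_star_def by (metis order_trans)
    then show ?thesis by simp
  qed
  show ?thesis
    using feas attack_optimal_exists[OF assms(3,7,4,5) feas]
      cost_bound[OF assms(3,7,4,5) star] by blast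
qed

end
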